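(* Every Eulerian orientation of the complete bipartite graph $K_{m,n}$ contains at least $\frac{1}{4+\sqrt{8}}\,mn\,(1-o(1))$ pairwise arc-disjoint copies of $C_4$, where the $o(1)$ term denotes a function tending to zero as $\min\{m,n\}$ tends to infinity. That is: for every $\epsilon>0$ there exists $M$ such that for all $m,n$ with $\min\{m,n\}\ge M$, every Eulerian orientation of $K_{m,n}$ contains at least $\frac{1}{4+\sqrt{8}}\,mn\,(1-\epsilon)$ pairwise arc-disjoint copies of $C_4$.
   Context: All graphs and digraphs are finite and contain no parallel edges or anti-parallel arcs. An Eulerian orientation of an undirected graph is an orientation of its edges such that every vertex has indegree equal to its outdegree. (So an Eulerian orientation of $K_{m,n}$ exists only if $m$ and $n$ are even.) $C_4$ denotes the directed cycle on four vertices. A copy of $C_4$ in a digraph is a subdigraph isomorphic to $C_4$; copies are arc-disjoint if no two of them share an arc. *)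

theory Defs
  imports Complex_Main "Graph_Theory.Graph_Theory"
begin

text \<open>
  As in \<^theory>\<open>Graph_Theory.Digraph\<close>, an undirected simple graph is a symmetric digraph
  (locale \<^locale>\<open>graph\<close>), each edge being represented by its two anti-parallel arcs. The locale
  \<^locale>\<open>digraph\<close> excludes loops and parallel arcs, but not anti-parallel ones; for orientations
  the latter are excluded by the third conjunct below.
\<close>

definition orientation :: "('a,'b) pre_digraph \<Rightarrow> ('a,'c) pre_digraph \<Rightarrow> bool" where
  "orientation D G \<longleftrightarrow>
     digraph D \<and> verts D = verts G \<and>
     arcs_ends D \<inter> (arcs_ends D)\<inverse> = {} \<and>
     arcs_ends D \<union> (arcs_ends D)\<inverse> = arcs_ends G"

definition eulerian_orientation :: "('a,'b) pre_digraph \<Rightarrow> ('a,'c) pre_digraph \<Rightarrow> bool" where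
  "eulerian_orientation D G \<longleftrightarrow>
     orientation D G \<and> (\<forall>v \<in> verts D. in_degree D v = out_degree D v)"

definition directed_C4 :: "(nat, nat \<times> nat) pre_digraph" where
  "directed_C4 = with_proj
     \<lparr> pverts = {0, 1, 2, 3}, parcs = {(0,1), (1,2), (2,3), (3,0)} \<rparr>"

definition C4_copy :: "('a,'b) pre_digraph \<Rightarrow> ('a,'b) pre_digraph \<Rightarrow> bool" where
  "C4_copy H D \<longleftrightarrow> subgraph H D \<and> digraph_iso H directed_C4"

definition pairwise_arc_disjoint :: "('a,'b) pre_digraph set \<Rightarrow> bool" where
  "pairwise_arc_disjoint F \<longleftrightarrow> pairwise (\<lambda>H H'. arcs H \<inter> arcs H' = {}) F"

end

theory Submission
  imports Defs "HOL-Number_Theory.Cong"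
begin

text \<open>
  Let \<open>U\<close> and \<open>V\<close> be the two sides, of sizes \<open>m\<close> and \<open>n\<close>. Every \<open>x \<in> U\<close> has out-degree \<open>n / 2\<close>, so for
  \<open>x, y \<in> U\<close> the number of \<open>v\<close> with \<open>x \<rightarrow> v \<rightarrow> y\<close> equals \<open>n / 2\<close> minus the number of common out-neighbours,
  which is symmetric in \<open>x\<close> and \<open>y\<close>. Any path \<open>x \<rightarrow> v \<rightarrow> y\<close> together with any path \<open>y \<rightarrow> w \<rightarrow> x\<close> is a
  directed 4-cycle. It therefore suffices to choose at each \<open>v \<in> V\<close> arc-disjoint paths through \<open>v\<close>, that
  is, a matching between in-neighbours and out-neighbours of \<open>v\<close>, such that every pair \<open>x, y\<close> gets
  almost equally many paths in both directions.

  Rounding is controlled by using only pairs inside blocks of a fixed size \<open>k\<close> of a partition of \<open>U\<close>.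
  Inside a block \<open>B\<close>, a vertex \<open>v\<close> with in-neighbours \<open>T\<close> in \<open>B\<close> can use the pairs \<open>T \<times> (B - T)\<close>. If
  \<open>T\<close> and \<open>B - T\<close> have at most \<open>r\<close> elements, these pairs decompose into \<open>r\<close> matchings. Distributing the
  vertices \<open>v\<close> with the same \<open>T\<close> evenly over the \<open>r\<close> matchings gives every pair a fraction \<open>1 / r\<close> of its
  paths, up to an error depending on \<open>k\<close> only (\<open>exists_matchings\<close>). The symmetry above then balances the
  two directions, except for the paths through vertices \<open>v\<close> which split \<open>B\<close> too unevenly
  (\<open>exists_C4_packing_in_block\<close>).

  A typical vertex splits a block almost evenly if the partition is chosen well. Write \<open>\<sigma> v x\<close> for \<open>1\<close> or
  \<open>-1\<close> according to the direction of the arc between \<open>x\<close> and \<open>v\<close>. The vectors \<open>\<sigma> _ x\<close> sum to zero over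
  \<open>x \<in> U\<close> because \<open>V\<close> is balanced too, and averaging yields a partition whose block sums have mean
  squared entries of order \<open>k\<close> (\<open>exists_balanced_partition\<close>). The block then contributes about
  \<open>k\<^sup>2 n / (8 r)\<close> cycles, and the \<open>m / k\<close> blocks together about \<open>k m n / (8 r)\<close>. With \<open>k = 100\<close> and
  \<open>r = 75\<close> the loss from uneven splits leaves \<open>0.155 m n\<close> cycles up to lower order terms, whereas
  \<open>1 / (4 + sqrt 8)\<close> is less than \<open>0.1465\<close>.
\<close>

section \<open>Partitions with small block sums\<close>

lemma bij_betw_cyclic_shift:
  fixes q s :: nat
  assumes "q > 0"
  shows "bij_betw (\<lambda>j. (j + s) mod q) {..<q} {..<q}"
proof (rule bij_betw_imageI)
  show inj: "inj_on (\<lambda>j. (j + s) mod q) {..<q}"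
  proof (rule inj_onI)
    fix i j assume "i \<in> {..<q}" "j \<in> {..<q}" "(i + s) mod q = (j + s) mod q"
    then show "i = j"
      using cong_add_rcancel_nat[of i s j q] by (auto simp: cong_def)
  qed
  show "(\<lambda>j. (j + s) mod q) ` {..<q} = {..<q}"
    using assms by (intro endo_inj_surj inj) auto
qed

lemma exists_le_average:
  fixes f :: "nat \<Rightarrow> real"
  assumes "q > 0"
  shows "\<exists>s<q. real q * f s \<le> (\<Sum>t<q. f t)"
proof (rule ccontr)
  assume "\<not> ?thesis"
  then have "(\<Sum>s<q. \<Sum>t<q. f t) < (\<Sum>s<q. real q * f s)"
    using assms by (intro sum_strict_mono) auto
  then show False by (simp add: sum_distrib_left)
qed

text \<open>
  Read \<open>\<sigma>\<close> as assigning to every \<open>x \<in> X\<close> a vector with entries in \<open>[-1, 1]\<close> indexed by \<open>V\<close>. Then \<open>X\<close>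
  splits into \<open>q\<close> blocks of size \<open>k\<close> whose vector sums have total squared length at most
  \<open>k q |V| + |S|\<^sup>2 / q\<close>, where \<open>S\<close> is the sum of all the vectors; this is what a random partition
  achieves on average. The blocks are built one layer of \<open>q\<close> new elements at a time: cyclically
  shifting a layer against the existing blocks gives \<open>q\<close> ways to attach it, and on average over the
  shifts the cross terms are \<open>1 / q\<close> times the inner product of the sum of the old elements with the
  sum of the layer.
\<close>

lemma exists_balanced_partition:
  fixes \<sigma> :: "'v \<Rightarrow> 'u \<Rightarrow> real"
  assumes "finite V" "q > 0" "finite X" "card X = q * k"
    and "\<And>v x. v \<in> V \<Longrightarrow> x \<in> X \<Longrightarrow> (\<sigma> v x)\<^sup>2 \<le> 1"
  shows "\<exists>g. (\<forall>x\<in>X. g x < q) \<and> (\<forall>j<q. card {x \<in> X. g x = j} = k) \<and>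
    (\<Sum>j<q. \<Sum>v\<in>V. (\<Sum>x | x \<in> X \<and> g x = j. \<sigma> v x)\<^sup>2)
      \<le> real (k * q * card V) + (\<Sum>v\<in>V. (\<Sum>x\<in>X. \<sigma> v x)\<^sup>2) / real q"
  using assms(3-5)
proof (induction k arbitrary: X)
  case 0
  then show ?case by auto
next
  case (Suc k)
  obtain Y where Y: "Y \<subseteq> X" "card Y = q * k" "finite Y"
    using obtain_subset_with_card_n[of "q * k" X] Suc.prems by auto
  define Z where "Z = X - Y"
  have Z: "finite Z" "card Z = q" "Y \<inter> Z = {}" "X = Y \<union> Z"
    using Suc.prems Y by (auto simp: Z_def card_Diff_subset)
  obtain h where h: "bij_betw h {..<q} Z"
    using ex_bij_betw_nat_finite[OF Z(1)] Z(2) by (auto simp: atLeast0LessThan)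
  have "\<And>v x. v \<in> V \<Longrightarrow> x \<in> Y \<Longrightarrow> (\<sigma> v x)\<^sup>2 \<le> 1" using Suc.prems Y by blast
  from Suc.IH[OF Y(3,2) this] obtain g where g: "\<And>x. x \<in> Y \<Longrightarrow> g x < q"
      "\<And>j. j < q \<Longrightarrow> card {x \<in> Y. g x = j} = k"
    and gsum: "(\<Sum>j<q. \<Sum>v\<in>V. (\<Sum>x | x \<in> Y \<and> g x = j. \<sigma> v x)\<^sup>2)
      \<le> real (k * q * card V) + (\<Sum>v\<in>V. (\<Sum>x\<in>Y. \<sigma> v x)\<^sup>2) / real q"
    by blast
  \<comment> \<open>\<open>P j\<close> is the sum of the old block \<open>j\<close>; \<open>I s\<close> is the total of the cross terms under shift \<open>s\<close>.\<close>
  define P where "P = (\<lambda>j v. \<Sum>x | x \<in> Y \<and> g x = j. \<sigma> v x)"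
  define I where "I = (\<lambda>s. \<Sum>j<q. \<Sum>v\<in>V. P j v * \<sigma> v (h ((j + s) mod q)))"
  have sumP: "(\<Sum>j<q. P j v) = (\<Sum>x\<in>Y. \<sigma> v x)" for v
    unfolding P_def by (rule sum.group) (use Y g in auto)
  have shift: "(\<Sum>s<q. f ((j + s) mod q)) = sum f {..<q}" for f :: "nat \<Rightarrow> real" and j
    using sum.reindex_bij_betw[OF bij_betw_cyclic_shift[OF assms(2), of j], of f]
    by (simp add: add.commute)
  have sumh: "(\<Sum>t<q. \<sigma> v (h t)) = (\<Sum>z\<in>Z. \<sigma> v z)" for v
    by (rule sum.reindex_bij_betw[OF h])
  have "(\<Sum>s<q. I s) = (\<Sum>j<q. \<Sum>v\<in>V. \<Sum>s<q. P j v * \<sigma> v (h ((j + s) mod q)))"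
    unfolding I_def by (subst sum.swap, rule sum.cong, simp, rule sum.swap)
  also have "\<dots> = (\<Sum>j<q. \<Sum>v\<in>V. P j v * (\<Sum>z\<in>Z. \<sigma> v z))"
    by (simp add: sum_distrib_left[symmetric] shift[of "\<lambda>t. \<sigma> _ (h t)"] sumh)
  also have "\<dots> = (\<Sum>v\<in>V. (\<Sum>x\<in>Y. \<sigma> v x) * (\<Sum>z\<in>Z. \<sigma> v z))"
    by (subst sum.swap) (simp add: sum_distrib_right[symmetric] sumP)
  finally have sumI: "(\<Sum>s<q. I s) = (\<Sum>v\<in>V. (\<Sum>x\<in>Y. \<sigma> v x) * (\<Sum>z\<in>Z. \<sigma> v z))" .
  obtain s where s: "real q * I s \<le> (\<Sum>v\<in>V. (\<Sum>x\<in>Y. \<sigma> v x) * (\<Sum>z\<in>Z. \<sigma> v z))"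
    using exists_le_average[OF assms(2), of I] sumI by auto
  define h' where "h' = (\<lambda>j. h ((j + s) mod q))"
  have h': "bij_betw h' {..<q} Z"
    using bij_betw_trans[OF bij_betw_cyclic_shift[OF assms(2), of s] h]
    by (simp add: h'_def comp_def)
  define g' where "g' = (\<lambda>x. if x \<in> Y then g x else the_inv_into {..<q} h' x)"
  have g'h: "g' (h' j) = j" "h' j \<in> Z" if "j < q" for j
    using that h' Z(3) the_inv_into_f_f[of h' "{..<q}" j]
    by (auto simp: g'_def bij_betw_def)
  have fib: "{x \<in> X. g' x = j} = insert (h' j) {x \<in> Y. g x = j}" if "j < q" for j
  proof -
    have "x = h' j" if "x \<in> Z" "g' x = j" for x
      using that g'h h' by (force simp: bij_betw_def)
    moreover have "g' x = g x" if "x \<in> Y" for x using that by (simp add: g'_def)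
    ultimately show ?thesis using g'h[OF that] Z(3) unfolding Z(4)
      by (intro set_eqI) (metis (mono_tags, lifting) UnE UnI1 UnI2 insert_iff mem_Collect_eq)
  qed
  have notin: "h' j \<notin> {x \<in> Y. g x = j}" if "j < q" for j using g'h(2)[OF that] Z(3) by auto
  have "g' x < q" if "x \<in> X" for x
  proof (cases "x \<in> Y")
    case True then show ?thesis using g by (simp add: g'_def)
  next
    case False
    then have "x \<in> h' ` {..<q}" using that Z(4) bij_betw_imp_surj_on[OF h'] by blast
    then obtain j where "j < q" "x = h' j" by blast
    then show ?thesis using g'h by simp
  qed
  moreover have "card {x \<in> X. g' x = j} = Suc k" if "j < q" for j
    using fib[OF that] notin[OF that] g(2)[OF that] Y(3) by simp
  moreover have "(\<Sum>j<q. \<Sum>v\<in>V. (\<Sum>x | x \<in> X \<and> g' x = j. \<sigma> v x)\<^sup>2)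
      \<le> real (Suc k * q * card V) + (\<Sum>v\<in>V. (\<Sum>x\<in>X. \<sigma> v x)\<^sup>2) / real q"
  proof -
    have "(\<Sum>j<q. \<Sum>v\<in>V. (\<Sum>x | x \<in> X \<and> g' x = j. \<sigma> v x)\<^sup>2)
        = (\<Sum>j<q. \<Sum>v\<in>V. (P j v)\<^sup>2 + 2 * (P j v * \<sigma> v (h' j)) + (\<sigma> v (h' j))\<^sup>2)"
      using fib notin Y(3) by (intro sum.cong refl) (simp add: P_def power2_sum)
    also have "\<dots> = (\<Sum>j<q. \<Sum>v\<in>V. (P j v)\<^sup>2) + 2 * I s + (\<Sum>j<q. \<Sum>v\<in>V. (\<sigma> v (h' j))\<^sup>2)"
      by (simp add: sum.distrib I_def h'_def sum_distrib_left[symmetric])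
    also have "(\<Sum>j<q. \<Sum>v\<in>V. (\<sigma> v (h' j))\<^sup>2) \<le> (\<Sum>j<q. \<Sum>v\<in>V. 1)"
      using g'h(2) Z(4) Suc.prems(3) by (intro sum_mono) auto
    also have "2 * I s \<le> (\<Sum>v\<in>V. 2 * ((\<Sum>x\<in>Y. \<sigma> v x) * (\<Sum>z\<in>Z. \<sigma> v z))) / q"
      using s assms(2) by (simp add: sum_distrib_left[symmetric] field_simps)
    also have "(\<Sum>j<q. \<Sum>v\<in>V. (P j v)\<^sup>2)
        \<le> real (k * q * card V) + (\<Sum>v\<in>V. (\<Sum>x\<in>Y. \<sigma> v x)\<^sup>2) / real q"
      using gsum by (simp add: P_def)
    finally have "(\<Sum>j<q. \<Sum>v\<in>V. (\<Sum>x | x \<in> X \<and> g' x = j. \<sigma> v x)\<^sup>2)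
      \<le> real (Suc k * q * card V) + (\<Sum>v\<in>V. (\<Sum>x\<in>Y. \<sigma> v x)\<^sup>2
          + 2 * ((\<Sum>x\<in>Y. \<sigma> v x) * (\<Sum>z\<in>Z. \<sigma> v z))) / q"
      by (simp add: sum.distrib add_divide_distrib algebra_simps)
    also have "(\<Sum>v\<in>V. (\<Sum>x\<in>Y. \<sigma> v x)\<^sup>2 + 2 * ((\<Sum>x\<in>Y. \<sigma> v x) * (\<Sum>z\<in>Z. \<sigma> v z)))
        \<le> (\<Sum>v\<in>V. (\<Sum>x\<in>X. \<sigma> v x)\<^sup>2)"
      using Y(3) Z by (intro sum_mono) (simp add: sum.union_disjoint power2_sum)
    finally show ?thesis by (simp add: divide_right_mono)
  qed
  ultimately show ?case by blast
qed

section \<open>Evenly distributed matchings\<close>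

lemma exists_balanced_colouring:
  fixes A :: "'x set"
  assumes "finite A" "r > 0"
  shows "\<exists>c. (\<forall>i<r. card A div r \<le> card {a \<in> A. c a = i})"
proof -
  obtain f where f: "bij_betw f A {..<card A}"
    using ex_bij_betw_finite_nat[OF assms(1)] by (auto simp: atLeast0LessThan)
  have "card A div r \<le> card {a \<in> A. f a mod r = i}" if "i < r" for i
  proof -
    have "f ` {a \<in> A. f a mod r = i} \<supseteq> (\<lambda>t. t * r + i) ` {..<card A div r}"
    proof
      fix y assume "y \<in> (\<lambda>t. t * r + i) ` {..<card A div r}"
      then obtain t where t: "t < card A div r" "y = t * r + i" by auto
      have "t * r + i < (t + 1) * r" using that by simp
      also have "\<dots> \<le> (card A div r) * r" using t(1) by (intro mult_right_mono) auto
      also have "\<dots> \<le> card A" by simp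
      finally have "y \<in> f ` A" using t(2) bij_betw_imp_surj_on[OF f] by simp
      then obtain a where "a \<in> A" "y = f a" by blast
      moreover have "y mod r = i" using t(2) that by simp
      ultimately show "y \<in> f ` {a \<in> A. f a mod r = i}" by blast
    qed
    then have "card ((\<lambda>t. t * r + i) ` {..<card A div r}) \<le> card (f ` {a \<in> A. f a mod r = i})"
      using assms(1) by (intro card_mono) auto
    also have "\<dots> \<le> card {a \<in> A. f a mod r = i}" using assms(1) by (intro card_image_le) auto
    finally show ?thesis using assms(2) by (subst (asm) card_image) (auto simp: inj_on_def)
  qed
  then show ?thesis by (intro exI[of _ "\<lambda>a. f a mod r"]) blast
qed

text \<open>
  The set \<open>T v\<close> is meant to be the set of in-neighbours of \<open>v\<close> in a block \<open>B\<close>, and \<open>M v x y\<close> says that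
  the path \<open>x \<rightarrow> v \<rightarrow> y\<close> is selected. The paths selected at \<open>v\<close> form a matching between \<open>T v\<close> and
  \<open>B - T v\<close>. When both sides have at most \<open>r\<close> elements, the complete bipartite graph between them is
  a union of \<open>r\<close> matchings, namely the level sets modulo \<open>r\<close> of the sum of two numberings; if the
  vertices \<open>v\<close> with the same \<open>T v\<close> are distributed evenly over these \<open>r\<close> matchings, then each pair
  \<open>(x, y)\<close> receives its fair share up to rounding, which costs at most one path for each of the
  \<open>2 ^ card B\<close> possible sets \<open>T v\<close>.
\<close>

lemma exists_matchings:
  fixes T :: "'v \<Rightarrow> 'u set"
  assumes "finite B" "finite V" "r > 0" "\<And>v. v \<in> V \<Longrightarrow> T v \<subseteq> B"
  obtains M :: "'v \<Rightarrow> 'u \<Rightarrow> 'u \<Rightarrow> bool" where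
    "\<And>v x y. v \<in> V \<Longrightarrow> M v x y \<Longrightarrow> x \<in> T v \<and> y \<in> B - T v"
    "\<And>v x y y'. v \<in> V \<Longrightarrow> M v x y \<Longrightarrow> M v x y' \<Longrightarrow> y = y'"
    "\<And>v x x' y. v \<in> V \<Longrightarrow> M v x y \<Longrightarrow> M v x' y \<Longrightarrow> x = x'"
    "\<And>x y. x \<in> B \<Longrightarrow> y \<in> B \<Longrightarrow> real (card {v \<in> V. M v x y}) \<ge>
      real (card {v \<in> V. card (T v) \<le> r \<and> card (B - T v) \<le> r \<and> x \<in> T v \<and> y \<notin> T v}) / real r
        - 2 ^ card B"
proof -
  have "\<exists>f. inj_on f S \<and> f ` S \<subseteq> {..<r}" if "S \<subseteq> B" "card S \<le> r" for S
  proof -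
    have "finite S" using that assms(1) finite_subset by blast
    then show ?thesis using card_le_inj[of S "{..<r}"] that by auto
  qed
  then have "\<exists>en. \<forall>S. S \<subseteq> B \<and> card S \<le> r \<longrightarrow> inj_on (en S) S \<and> (en S) ` S \<subseteq> {..<r}"
    by (intro choice) blast
  then obtain en where en0: "\<forall>S. S \<subseteq> B \<and> card S \<le> r \<longrightarrow> inj_on (en S) S \<and> (en S) ` S \<subseteq> {..<r}"
    by blast
  have en: "\<And>S. S \<subseteq> B \<Longrightarrow> card S \<le> r \<Longrightarrow> inj_on (en S) S"
     "\<And>S x. S \<subseteq> B \<Longrightarrow> card S \<le> r \<Longrightarrow> x \<in> S \<Longrightarrow> en S x < r"
    using en0 by blast+
  have "\<exists>col. \<forall>S. \<forall>i<r. card {v \<in> V. T v = S} div r \<le> card {a \<in> {v \<in> V. T v = S}. col S a = i}"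
    by (intro choice allI exists_balanced_colouring) (use assms in auto)
  then obtain col where
    col: "\<And>S i. i < r \<Longrightarrow> card {v \<in> V. T v = S} div r \<le> card {a \<in> {v \<in> V. T v = S}. col S a = i}"
    by blast
  define good where "good = (\<lambda>v. card (T v) \<le> r \<and> card (B - T v) \<le> r)"
  define M where "M = (\<lambda>v x y. good v \<and> x \<in> T v \<and> y \<in> B - T v \<and>
    (en (T v) x + en (B - T v) y) mod r = col (T v) v)"
  have canc: "a = b" if "(a + c) mod r = (b + c) mod r" "a < r" "b < r" for a b c
    using that cong_add_rcancel_nat[of a c b r] by (auto simp: cong_def)
  show thesis
  proof (rule that[of M])
    fix v x y assume "M v x y" then show "x \<in> T v \<and> y \<in> B - T v" by (auto simp: M_def)
  next
    fix v x y y' assume "v \<in> V" and M: "M v x y" "M v x y'"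
    have "en (B - T v) y = en (B - T v) y'"
      by (rule canc[of _ "en (T v) x"]) (use M en(2)[of "B - T v"] in \<open>auto simp: M_def good_def add.commute\<close>)
    then show "y = y'" using M en(1)[of "B - T v"] by (auto simp: M_def good_def inj_on_def)
  next
    fix v x x' y assume v: "v \<in> V" and M: "M v x y" "M v x' y"
    have "en (T v) x = en (T v) x'"
      by (rule canc[of _ "en (B - T v) y"]) (use M en(2)[of "T v"] assms(4)[OF v] in \<open>auto simp: M_def good_def\<close>)
    then show "x = x'" using M en(1)[of "T v"] assms(4)[OF v] by (auto simp: M_def good_def inj_on_def)
  next
    fix x y assume xy: "x \<in> B" "y \<in> B"
    define G where "G = {v \<in> V. good v \<and> x \<in> T v \<and> y \<notin> T v}"
    define L where "L = {v \<in> V. M v x y}"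
    have fin: "finite G" "finite L" using assms(2) by (auto simp: G_def L_def)
    have sub: "T ` G \<subseteq> Pow B" "T ` L \<subseteq> Pow B" using assms(4) by (auto simp: G_def L_def)
    have "card {v \<in> G. T v = S} \<le> r * (card {v \<in> L. T v = S} + 1)" if "S \<in> Pow B" for S
    proof (cases "{v \<in> G. T v = S} = {}")
      case False
      then have S: "card S \<le> r" "card (B - S) \<le> r" "x \<in> S" "y \<notin> S"
        by (auto simp: G_def good_def)
      define i where "i = (en S x + en (B - S) y) mod r"
      have G: "{v \<in> G. T v = S} = {v \<in> V. T v = S}" using S by (auto simp: G_def good_def)
      have L: "{v \<in> L. T v = S} = {v \<in> {v \<in> V. T v = S}. col S v = i}"
        using S xy by (auto simp: L_def M_def good_def i_def)
      have "card {v \<in> V. T v = S} div r \<le> card {v \<in> L. T v = S}"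
        unfolding L by (rule col) (simp add: i_def assms(3))
      then have "card {v \<in> V. T v = S} < r * (card {v \<in> L. T v = S} + 1)"
        using assms(3) by (simp add: div_less_iff_less_mult flip: less_Suc_eq_le mult.commute[of r])
      then show ?thesis using G by simp
      next
      case True
      show ?thesis unfolding True by simp
    qed
    then have "(\<Sum>S\<in>Pow B. card {v \<in> G. T v = S}) \<le> (\<Sum>S\<in>Pow B. r * (card {v \<in> L. T v = S} + 1))"
      by (rule sum_mono)
    also have "(\<Sum>S\<in>Pow B. card {v \<in> G. T v = S}) = card G"
      using sum.group[OF fin(1) _ sub(1), of "\<lambda>_. 1::nat"] assms(1) by simp
    also have "(\<Sum>S\<in>Pow B. r * (card {v \<in> L. T v = S} + 1)) = r * (card L + 2 ^ card B)"
      using sum.group[OF fin(2) _ sub(2), of "\<lambda>_. 1::nat"] assms(1)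
      by (simp add: sum_distrib_left[symmetric] sum.distrib card_Pow algebra_simps)
    finally have "real (card G) \<le> real (r * (card L + 2 ^ card B))" by (rule of_nat_mono)
    then have "real (card G) / real r \<le> real (card L) + 2 ^ card B"
      using assms(3) by (simp add: field_simps)
    then show "real (card {v \<in> V. M v x y}) \<ge>
      real (card {v \<in> V. card (T v) \<le> r \<and> card (B - T v) \<le> r \<and> x \<in> T v \<and> y \<notin> T v}) / real r
        - 2 ^ card B"
      by (simp add: G_def L_def good_def conj_ac)
  qed
qed

section \<open>Packings of directed 4-cycles\<close>

text \<open>
  A tuple \<open>(x, v, y, w)\<close> stands for the directed 4-cycle \<open>x \<rightarrow> v \<rightarrow> y \<rightarrow> w \<rightarrow> x\<close>; its arcs are given by
  their end points.
\<close>

definition C4_arcs :: "'a \<times> 'a \<times> 'a \<times> 'a \<Rightarrow> ('a \<times> 'a) set" where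
  "C4_arcs = (\<lambda>(x, v, y, w). {(x, v), (v, y), (y, w), (w, x)})"

text \<open>
  A packing of arc-disjoint directed 4-cycles in the arc relation \<open>E\<close>. Every cycle is represented by
  only one of its four rotations: two rotations have the same arcs, so they cannot both be present.
\<close>

definition C4_packing :: "('a \<times> 'a) set \<Rightarrow> ('a \<times> 'a \<times> 'a \<times> 'a) set \<Rightarrow> bool" where
  "C4_packing E Q \<longleftrightarrow> finite Q \<and> (\<forall>(x, v, y, w) \<in> Q. distinct [x, v, y, w]) \<and>
     (\<forall>c\<in>Q. C4_arcs c \<subseteq> E) \<and> disjoint_family_on C4_arcs Q"

text \<open>
  For each pair in \<open>P\<close>, selected paths \<open>x \<rightarrow> v \<rightarrow> y\<close> are combined with selected paths \<open>y \<rightarrow> w \<rightarrow> x\<close>, as long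
  as both are available. The matching property of \<open>M v\<close> makes the cycles for different pairs
  arc-disjoint. \<open>P\<close> contains at most one of \<open>(x, y)\<close> and \<open>(y, x)\<close>, since both would use the same paths.
\<close>

lemma exists_C4_packing_of_matchings:
  fixes M :: "'a \<Rightarrow> 'a \<Rightarrow> 'a \<Rightarrow> bool"
  assumes fin: "finite B" "finite V" and BV: "B \<inter> V = {}"
    and M: "\<And>v x y. v \<in> V \<Longrightarrow> M v x y \<Longrightarrow> x \<in> B \<and> y \<in> B \<and> (x, v) \<in> E \<and> (v, y) \<in> E"
      "\<And>v x y y'. v \<in> V \<Longrightarrow> M v x y \<Longrightarrow> M v x y' \<Longrightarrow> y = y'"
      "\<And>v x x' y. v \<in> V \<Longrightarrow> M v x y \<Longrightarrow> M v x' y \<Longrightarrow> x = x'"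
    and asym: "\<And>x v. (x, v) \<in> E \<Longrightarrow> (v, x) \<notin> E"
    and P: "P \<subseteq> B \<times> B" "\<And>x y. (x, y) \<in> P \<Longrightarrow> (y, x) \<notin> P"
  shows "\<exists>Q. C4_packing (E \<inter> (B \<times> V \<union> V \<times> B)) Q \<and>
    card Q = (\<Sum>(x, y)\<in>P. min (card {v \<in> V. M v x y}) (card {v \<in> V. M v y x}))"
proof -
  define L where "L = (\<lambda>(x, y). {v \<in> V. M v x y})"
  have finL: "finite (L p)" for p using fin by (auto simp: L_def split: prod.splits)
  have "\<exists>A f. A \<subseteq> L p \<and> card A = min (card (L p)) (card (L (prod.swap p))) \<and>
      inj_on f A \<and> f ` A \<subseteq> L (prod.swap p)" for p
  proof -
    obtain A where A: "A \<subseteq> L p" "card A = min (card (L p)) (card (L (prod.swap p)))" "finite A"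
      using obtain_subset_with_card_n[of "min (card (L p)) (card (L (prod.swap p)))" "L p"] by auto
    moreover obtain f where "f ` A \<subseteq> L (prod.swap p)" "inj_on f A"
      using card_le_inj[OF A(3) finL[of "prod.swap p"]] A(2) by auto
    ultimately show ?thesis by blast
  qed
  then obtain A f where A: "\<And>p. A p \<subseteq> L p"
      "\<And>p. card (A p) = min (card (L p)) (card (L (prod.swap p)))"
    and f: "\<And>p. inj_on (f p) (A p)" "\<And>p. f p ` A p \<subseteq> L (prod.swap p)"
    by metis
  define c where "c = (\<lambda>((x, y), v). (x, v, y, f (x, y) v))"
  define Q where "Q = c ` Sigma P A"
  have finP: "finite P" using P(1) fin(1) finite_subset by blast
  have finA: "finite (A p)" for p using A(1) finL finite_subset by blast
  have "inj_on c (Sigma P A)" by (auto simp: inj_on_def c_def)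
  then have "card Q = (\<Sum>p\<in>P. card (A p))"
    using finP finA by (simp add: Q_def card_image)
  also have "\<dots> = (\<Sum>(x, y)\<in>P. min (card {v \<in> V. M v x y}) (card {v \<in> V. M v y x}))"
    by (intro sum.cong refl) (auto simp: A(2) L_def)
  finally have card: "card Q = \<dots>" .
  have mem: "x \<in> B" "y \<in> B" "v \<in> V" "w \<in> V" "(x, y) \<in> P" "M v x y" "M w y x"
      "v \<in> A (x, y)" "w = f (x, y) v" "(x, v) \<in> E" "(v, y) \<in> E" "(y, w) \<in> E" "(w, x) \<in> E"
      "distinct [x, v, y, w]"
    if "(x, v, y, w) \<in> Q" for x v y w
  proof -
    from that show *: "(x, y) \<in> P" "v \<in> A (x, y)" "w = f (x, y) v"
      by (auto simp: Q_def c_def)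
    then have "w \<in> L (y, x)" using f(2)[of "(x, y)"] by auto
    then show **: "v \<in> V" "w \<in> V" "M v x y" "M w y x"
      using * A(1)[of "(x, y)"] by (auto simp: L_def)
    from M(1)[OF **(1,3)] M(1)[OF **(2,4)]
    show ***: "x \<in> B" "y \<in> B" "(x, v) \<in> E" "(v, y) \<in> E" "(y, w) \<in> E" "(w, x) \<in> E" by auto
    then show "distinct [x, v, y, w]" using ** BV asym by auto
  qed
  have "C4_packing (E \<inter> (B \<times> V \<union> V \<times> B)) Q"
    unfolding C4_packing_def
  proof (intro conjI ballI)
    show "finite Q" using finP finA by (auto simp: Q_def)
    fix q assume q: "q \<in> Q"
    obtain x v y w where qe: "q = (x, v, y, w)" by (cases q)
    note m = mem[OF q[unfolded qe]]
    show "case q of (x, v, y, w) \<Rightarrow> distinct [x, v, y, w]" using m(14) by (simp add: qe)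
    show "C4_arcs q \<subseteq> E \<inter> (B \<times> V \<union> V \<times> B)" using m by (simp add: qe C4_arcs_def)
  next
    show "disjoint_family_on C4_arcs Q"
      unfolding disjoint_family_on_def
    proof (intro ballI impI, rule ccontr)
      fix q q' assume q: "q \<in> Q" "q' \<in> Q" "q \<noteq> q'" and int: "C4_arcs q \<inter> C4_arcs q' \<noteq> {}"
      obtain x v y w where qe: "q = (x, v, y, w)" by (cases q)
      obtain x' v' y' w' where qe': "q' = (x', v', y', w')" by (cases q')
      note m = mem[OF q(1)[unfolded qe]] and m' = mem[OF q(2)[unfolded qe']]
      have neq: "a \<noteq> b" if "a \<in> B" "b \<in> V" for a b using that BV by blast
      have same: "x = x' \<and> y = y'" if "v = v' \<or> w = w'" "x = x' \<or> y = y'"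
        using that M(2)[of v x y y'] M(3)[of v x y x'] M(2)[of w y x x'] M(3)[of w y x y'] m m'
        by auto
      have v: False if "v = v'" "x = x' \<or> y = y'"
        using same that q(3) qe qe' m(9) m'(9) by simp
      have w: False if "w = w'" "x = x' \<or> y = y'"
      proof -
        have xy: "x = x' \<and> y = y'" using same that by simp
        then have "v = v'"
          using inj_onD[OF f(1)[of "(x, y)"], of v v'] m(8,9) m'(8,9) that by simp
        then show False using v xy by simp
      qed
      have opp: False if "v = w' \<or> w = v'" "x = y' \<or> y = x'"
      proof -
        have "x = y' \<and> y = x'"
          using that M(2)[of v x y x'] M(3)[of v x y y'] M(2)[of w y x y'] M(3)[of w y x x'] m m'
          by auto
        then show False using m(5) m'(5) P(2) by simp
      qed
      obtain e where "e \<in> C4_arcs q" "e \<in> C4_arcs q'" using int by blast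
      then have "(e = (x, v) \<or> e = (v, y) \<or> e = (y, w) \<or> e = (w, x)) \<and>
          (e = (x', v') \<or> e = (v', y') \<or> e = (y', w') \<or> e = (w', x'))"
        by (simp add: qe qe' C4_arcs_def)
      then show False
        using v w opp neq[OF m(1) m'(3)] neq[OF m(1) m'(4)] neq[OF m(2) m'(3)] neq[OF m(2) m'(4)]
          neq[OF m'(1) m(3)] neq[OF m'(1) m(4)] neq[OF m'(2) m(3)] neq[OF m'(2) m(4)]
        by (elim conjE disjE) simp_all
    qed
  qed
  with card show ?thesis by blast
qed

lemma C4_packing_UN:
  fixes E :: "'i \<Rightarrow> ('a \<times> 'a) set"
  assumes "finite J" "\<And>j. j \<in> J \<Longrightarrow> C4_packing (E j) (Q j)" "disjoint_family_on E J"
  shows "C4_packing (\<Union>j\<in>J. E j) (\<Union>j\<in>J. Q j)" "card (\<Union>j\<in>J. Q j) = (\<Sum>j\<in>J. card (Q j))"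
proof -
  have fin: "finite (Q j)" and dist: "\<And>c. c \<in> Q j \<Longrightarrow> (case c of (x, v, y, w) \<Rightarrow> distinct [x, v, y, w])"
    and sub: "\<And>c. c \<in> Q j \<Longrightarrow> C4_arcs c \<subseteq> E j"
    and dis: "\<And>c c'. c \<in> Q j \<Longrightarrow> c' \<in> Q j \<Longrightarrow> c \<noteq> c' \<Longrightarrow> C4_arcs c \<inter> C4_arcs c' = {}"
    if "j \<in> J" for j
    using assms(2)[OF that] unfolding C4_packing_def disjoint_family_on_def by blast+
  have cross: "C4_arcs c \<inter> C4_arcs c' = {}" if "i \<in> J" "j \<in> J" "i \<noteq> j" "c \<in> Q i" "c' \<in> Q j" for i j c c'
  proof -
    have "E i \<inter> E j = {}" using assms(3) that by (simp add: disjoint_family_on_def)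
    then show ?thesis using sub that by blast
  qed
  have ne: "C4_arcs c \<noteq> {}" for c :: "'a \<times> 'a \<times> 'a \<times> 'a" by (auto simp: C4_arcs_def split: prod.splits)
  have "Q i \<inter> Q j = {}" if "i \<in> J" "j \<in> J" "i \<noteq> j" for i j
  proof (rule equals0I)
    fix c assume "c \<in> Q i \<inter> Q j"
    then show False using cross[OF that, of c c] ne[of c] by simp
  qed
  then show "card (\<Union>j\<in>J. Q j) = (\<Sum>j\<in>J. card (Q j))"
    using assms(1) fin by (intro card_UN_disjoint) auto
  have "C4_arcs c \<inter> C4_arcs c' = {}" if c: "c \<in> (\<Union>j\<in>J. Q j)" "c' \<in> (\<Union>j\<in>J. Q j)" "c \<noteq> c'" for c c'
  proof -
    obtain i j where "i \<in> J" "c \<in> Q i" "j \<in> J" "c' \<in> Q j" using c by blast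
    then show ?thesis using cross dis c(3) by (cases "i = j") auto
  qed
  moreover have "finite (\<Union>j\<in>J. Q j)" using assms(1) fin by blast
  moreover have "\<forall>(x, v, y, w)\<in>(\<Union>j\<in>J. Q j). distinct [x, v, y, w]" using dist by blast
  moreover have "\<forall>c\<in>(\<Union>j\<in>J. Q j). C4_arcs c \<subseteq> (\<Union>j\<in>J. E j)" using sub by blast
  ultimately show "C4_packing (\<Union>j\<in>J. E j) (\<Union>j\<in>J. Q j)"
    unfolding C4_packing_def disjoint_family_on_def by simp
qed

lemma C4_packing_mono: "C4_packing E Q \<Longrightarrow> E \<subseteq> E' \<Longrightarrow> C4_packing E' Q"
  unfolding C4_packing_def by blast

section \<open>Packing inside a block\<close>

lemma real_card_eq_sum_of_bool:
  assumes "finite A"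
  shows "real (card {a \<in> A. P a}) = (\<Sum>a\<in>A. of_bool (P a))"
  using assms by (simp add: Int_def)

lemma sum_symmetrised_pairs:
  fixes F :: "'a \<Rightarrow> 'a \<Rightarrow> real" and e :: "'a \<Rightarrow> nat"
  assumes "finite B" "inj_on e B" "\<And>x. x \<in> B \<Longrightarrow> F x x = 0"
  shows "(\<Sum>(x, y)\<in>{(x, y). x \<in> B \<and> y \<in> B \<and> e x < e y}. F x y + F y x) = (\<Sum>x\<in>B. \<Sum>y\<in>B. F x y)"
proof -
  define P where "P = {(x, y). x \<in> B \<and> y \<in> B \<and> e x < e y}"
  have P: "P \<subseteq> B \<times> B" "finite P" 
    using finite_subset[of P "B \<times> B"] assms(1) by (auto simp: P_def)
  have dec: "B \<times> B = (P \<union> prod.swap ` P) \<union> Id_on B"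
  proof
    show "B \<times> B \<subseteq> (P \<union> prod.swap ` P) \<union> Id_on B"
    proof
      fix p assume p: "p \<in> B \<times> B"
      obtain x y where xy: "p = (x, y)" by (cases p)
      have "e x < e y \<or> e y < e x \<or> x = y" using assms(2) p xy by (metis inj_onD linorder_neqE_nat SigmaE2)
      then show "p \<in> (P \<union> prod.swap ` P) \<union> Id_on B"
        using p unfolding xy by (auto simp: P_def image_iff)
    qed
  qed (auto simp: P_def)
  have "(\<Sum>(x, y)\<in>B \<times> B. F x y) = (\<Sum>(x, y)\<in>P. F x y) + (\<Sum>(x, y)\<in>prod.swap ` P. F x y)
      + (\<Sum>(x, y)\<in>Id_on B. F x y)"
  proof -
    have "finite (prod.swap ` P)" "P \<inter> prod.swap ` P = {}" "(P \<union> prod.swap ` P) \<inter> Id_on B = {}"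
      using P(2) by (auto simp: P_def)
    moreover have "finite (Id_on B)"
      by (rule finite_subset[of _ "B \<times> B"]) (use assms(1) in auto)
    ultimately show ?thesis unfolding dec using P(2) by (simp add: sum.union_disjoint)
  qed
  also have "(\<Sum>(x, y)\<in>Id_on B. F x y) = 0"
    by (rule sum.neutral) (use assms(3) in auto)
  also have "(\<Sum>(x, y)\<in>prod.swap ` P. F x y) = (\<Sum>(x, y)\<in>P. F y x)"
    by (subst sum.reindex) (auto simp: case_prod_unfold)
  finally show ?thesis
    by (simp add: sum.cartesian_product P_def[symmetric] sum.distrib[symmetric] split_beta)
qed

text \<open>
  A vertex \<open>v\<close> with \<open>a\<close> in-neighbours and \<open>b\<close> out-neighbours in a block of size \<open>4 * t\<close> lies on \<open>a * b\<close>
  paths through the block; such a path counts \<open>1/2\<close> if \<open>v\<close> is split evenly enough for the matchings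
  with \<open>r = 3 * t\<close>, and \<open>-1/2\<close> otherwise.
\<close>

lemma block_contribution_bound:
  fixes a b t :: nat
  assumes "a + b = 4 * t"
  shows "2 * (real t)\<^sup>2 - 7 / 8 * (real a - real b)\<^sup>2
    \<le> (1 / 2 - of_bool (\<not> (a \<le> 3 * t \<and> b \<le> 3 * t))) * (real a * real b)"
proof -
  define z where "z = real a - real b"
  have "real a + real b = 4 * real t" using arg_cong[OF assms, of real] by simp
  then have ab: "real a = 2 * real t + z / 2" "real b = 2 * real t - z / 2" by (simp_all add: z_def field_simps)
  have prod: "real a * real b = 4 * (real t)\<^sup>2 - z\<^sup>2 / 4"
    unfolding ab by (simp add: algebra_simps power2_eq_square)
  show ?thesis
  proof (cases "a \<le> 3 * t \<and> b \<le> 3 * t")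
    case True
    then show ?thesis unfolding z_def[symmetric] prod by simp
  next
    case False
    then have "real a \<ge> 3 * real t \<or> real b \<ge> 3 * real t" by auto
    then have "2 * real t \<le> \<bar>z\<bar>" unfolding ab by auto
    then have "(2 * real t)\<^sup>2 \<le> z\<^sup>2" by (metis abs_le_square_iff abs_of_nonneg of_nat_0_le_iff zero_le_mult_iff zero_le_numeral)
    then show ?thesis using False unfolding z_def[symmetric] prod by (simp add: field_simps)
  qed
qed

text \<open>
  All vertices of the block have the same out-degree \<open>h\<close> into \<open>V\<close>, so there are as many paths
  \<open>x \<rightarrow> v \<rightarrow> y\<close> as paths \<open>y \<rightarrow> v \<rightarrow> x\<close>. Hence only the paths through unevenly split vertices, which the
  matchings leave out, and rounding can unbalance the two directions.
\<close>

lemma exists_C4_packing_in_block: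
  fixes B V :: "'a set" and t :: nat
  assumes fin: "finite B" "finite V" and BV: "B \<inter> V = {}"
    and asym: "\<And>x v. (x, v) \<in> E \<Longrightarrow> (v, x) \<notin> E"
    and cross: "\<And>x v. x \<in> B \<Longrightarrow> v \<in> V \<Longrightarrow> (x, v) \<in> E \<or> (v, x) \<in> E"
    and deg: "\<And>x. x \<in> B \<Longrightarrow> card {v \<in> V. (x, v) \<in> E} = h"
    and t: "card B = 4 * t" "t > 0"
  shows "\<exists>Q. C4_packing (E \<inter> (B \<times> V \<union> V \<times> B)) Q \<and> real (card Q) \<ge>
    (\<Sum>v\<in>V. 2 * (real t)\<^sup>2 -
        7 / 8 * (real (card {x \<in> B. (x, v) \<in> E}) - real (card {x \<in> B. (v, x) \<in> E}))\<^sup>2) / (3 * real t)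
      - (4 * real t)\<^sup>2 * 2 ^ (4 * t)"
proof -
  define T where "T = (\<lambda>v. {x \<in> B. (x, v) \<in> E})"
  define good where "good = (\<lambda>v. card (T v) \<le> 3 * t \<and> card (B - T v) \<le> 3 * t)"
  have TB: "B - T v = {x \<in> B. (v, x) \<in> E}" if "v \<in> V" for v
    using cross asym that by (auto simp: T_def)
  have Tsub: "T v \<subseteq> B" for v by (auto simp: T_def)
  have t3: "3 * t > 0" using t(2) by simp
  obtain M where M: "\<And>v x y. v \<in> V \<Longrightarrow> M v x y \<Longrightarrow> x \<in> T v \<and> y \<in> B - T v"
    "\<And>v x y y'. v \<in> V \<Longrightarrow> M v x y \<Longrightarrow> M v x y' \<Longrightarrow> y = y'"
    "\<And>v x x' y. v \<in> V \<Longrightarrow> M v x y \<Longrightarrow> M v x' y \<Longrightarrow> x = x'"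
    "\<And>x y. x \<in> B \<Longrightarrow> y \<in> B \<Longrightarrow> real (card {v \<in> V. M v x y}) \<ge>
      real (card {v \<in> V. card (T v) \<le> 3 * t \<and> card (B - T v) \<le> 3 * t \<and> x \<in> T v \<and> y \<notin> T v})
        / real (3 * t) - 2 ^ card B"
  proof (rule exists_matchings[of B V "3 * t" T, OF fin t3 Tsub], goal_cases)
    case (1 M)
    show ?case by (rule 1(1)[OF 1(2-5)])
  qed
  obtain e :: "'a \<Rightarrow> nat" where e: "inj_on e B"
    using finite_imp_inj_to_nat_seg[OF fin(1)] by auto
  define P where "P = {(x, y). x \<in> B \<and> y \<in> B \<and> e x < e y}"
  have Psub: "P \<subseteq> B \<times> B" by (auto simp: P_def)
  have "\<exists>Q. C4_packing (E \<inter> (B \<times> V \<union> V \<times> B)) Q \<and>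
    card Q = (\<Sum>(x, y)\<in>P. min (card {v \<in> V. M v x y}) (card {v \<in> V. M v y x}))"
  proof (rule exists_C4_packing_of_matchings[OF fin BV _ M(2,3) asym Psub])
    show "x \<in> B \<and> y \<in> B \<and> (x, v) \<in> E \<and> (v, y) \<in> E" if "v \<in> V" "M v x y" for v x y
      using M(1)[OF that] TB[OF that(1)] by (auto simp: T_def)
    show "(y, x) \<notin> P" if "(x, y) \<in> P" for x y using that by (auto simp: P_def)
  qed
  then obtain Q where Q: "C4_packing (E \<inter> (B \<times> V \<union> V \<times> B)) Q"
    "card Q = (\<Sum>(x, y)\<in>P. min (card {v \<in> V. M v x y}) (card {v \<in> V. M v y x}))" by blast

  \<comment> \<open>\<open>d x y\<close> counts all paths from \<open>x\<close> to \<open>y\<close>, and \<open>\<beta> x y\<close> those through unevenly split vertices.\<close>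
  define d where "d = (\<lambda>x y. real (card {v \<in> V. x \<in> T v \<and> y \<notin> T v}))"
  define \<beta> where "\<beta> = (\<lambda>x y. real (card {v \<in> V. \<not> good v \<and> x \<in> T v \<and> y \<notin> T v}))"
  have d_sym: "d x y = d y x" if "x \<in> B" "y \<in> B" for x y
  proof -
    have *: "card {v \<in> V. x \<in> T v \<and> y \<notin> T v} + card {v \<in> V. x \<in> T v \<and> y \<in> T v} = h"
      if "x \<in> B" "y \<in> B" for x y
    proof -
      have "{v \<in> V. (x, v) \<in> E} = {v \<in> V. x \<in> T v \<and> y \<notin> T v} \<union> {v \<in> V. x \<in> T v \<and> y \<in> T v}"
        using that by (auto simp: T_def)
      then show ?thesis using deg[OF that(1)] fin by (simp, subst card_Un_disjoint[symmetric]) auto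
    qed
    show ?thesis using *[OF that] *[OF that(2,1)] by (simp add: d_def conj_commute)
  qed
  have good_card: "real (card {v \<in> V. good v \<and> x \<in> T v \<and> y \<notin> T v}) = d x y - \<beta> x y" for x y
  proof -
    have "{v \<in> V. x \<in> T v \<and> y \<notin> T v} = {v \<in> V. good v \<and> x \<in> T v \<and> y \<notin> T v} \<union>
        {v \<in> V. \<not> good v \<and> x \<in> T v \<and> y \<notin> T v}" by auto
    then have "card {v \<in> V. x \<in> T v \<and> y \<notin> T v} = card {v \<in> V. good v \<and> x \<in> T v \<and> y \<notin> T v} +
        card {v \<in> V. \<not> good v \<and> x \<in> T v \<and> y \<notin> T v}"
      using fin by (simp, subst card_Un_disjoint[symmetric]) auto
    then show ?thesis by (simp add: d_def \<beta>_def)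
  qed
  \<comment> \<open>The minimum of \<open>d x y - \<beta> x y\<close> and \<open>d y x - \<beta> y x\<close> is at least \<open>d x y - \<beta> x y - \<beta> y x\<close>,\<close>
  \<comment> \<open>which by the symmetry of \<open>d\<close> equals \<open>F x y + F y x\<close>.\<close>
  define F where "F = (\<lambda>x y. d x y / 2 - \<beta> x y)"
  have pair: "(F x y + F y x) / (3 * real t) - 2 ^ (4 * t)
      \<le> real (min (card {v \<in> V. M v x y}) (card {v \<in> V. M v y x}))" if "(x, y) \<in> P" for x y
  proof -
    have xy: "x \<in> B" "y \<in> B" using that Psub by auto
    have nn: "\<beta> x y \<ge> 0" "\<beta> y x \<ge> 0" by (simp_all add: \<beta>_def)
    have le1: "F x y + F y x \<le> d x y - \<beta> x y" and le2: "F x y + F y x \<le> d y x - \<beta> y x"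
      using d_sym[OF xy] nn by (simp_all add: F_def)
    have "(F x y + F y x) / (3 * real t) \<le> (d x y - \<beta> x y) / (3 * real t)"
      "(F x y + F y x) / (3 * real t) \<le> (d y x - \<beta> y x) / (3 * real t)"
      by (rule divide_right_mono[OF le1], simp) (rule divide_right_mono[OF le2], simp)
    moreover have "(d x y - \<beta> x y) / (3 * real t) - 2 ^ (4 * t) \<le> real (card {v \<in> V. M v x y})"
      using M(4)[OF xy] good_card[of x y] by (simp add: good_def t(1) conj_ac)
    moreover have "(d y x - \<beta> y x) / (3 * real t) - 2 ^ (4 * t) \<le> real (card {v \<in> V. M v y x})"
      using M(4)[OF xy(2,1)] good_card[of y x] by (simp add: good_def t(1) conj_ac)
    ultimately show ?thesis by (simp add: min_def)
  qed
  have "card P \<le> card (B \<times> B)" using Psub fin by (intro card_mono) auto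
  then have "real (card P) \<le> real (4 * t * (4 * t))"
    by (simp only: card_cartesian_product t(1) of_nat_le_iff)
  then have cardP: "real (card P) \<le> (4 * real t)\<^sup>2" by (simp add: power2_eq_square)
  have "(\<Sum>x\<in>B. \<Sum>y\<in>B. F x y) = (\<Sum>x\<in>B. \<Sum>y\<in>B. \<Sum>v\<in>V.
      (1 / 2 - of_bool (\<not> good v)) * (of_bool (x \<in> T v) * of_bool (y \<notin> T v)))"
  proof (intro sum.cong refl)
    fix x y
    have "d x y = (\<Sum>v\<in>V. of_bool (x \<in> T v) * of_bool (y \<notin> T v))"
      by (simp add: d_def real_card_eq_sum_of_bool[OF fin(2)] of_bool_conj)
    moreover have "\<beta> x y = (\<Sum>v\<in>V. of_bool (\<not> good v) * (of_bool (x \<in> T v) * of_bool (y \<notin> T v)))"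
      by (simp add: \<beta>_def real_card_eq_sum_of_bool[OF fin(2)] of_bool_conj)
    ultimately show "F x y = (\<Sum>v\<in>V. (1 / 2 - of_bool (\<not> good v)) * (of_bool (x \<in> T v) * of_bool (y \<notin> T v)))"
      by (simp only: F_def sum_subtractf left_diff_distrib sum_divide_distrib) simp
  qed
  also have "\<dots> = (\<Sum>v\<in>V. \<Sum>x\<in>B. \<Sum>y\<in>B. 
      (1 / 2 - of_bool (\<not> good v)) * (of_bool (x \<in> T v) * of_bool (y \<notin> T v)))"
  proof -
    have swap: "(\<Sum>y\<in>B. \<Sum>v\<in>V. G y v) = (\<Sum>v\<in>V. \<Sum>y\<in>B. G y v)" for G :: "'a \<Rightarrow> 'a \<Rightarrow> real"
      by (rule sum.swap)
    show ?thesis by (simp only: swap)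
  qed
  also have "\<dots> = (\<Sum>v\<in>V. (1 / 2 - of_bool (\<not> good v)) *
      ((\<Sum>x\<in>B. of_bool (x \<in> T v)) * (\<Sum>y\<in>B. of_bool (y \<notin> T v))))"
    by (simp only: sum_distrib_left[symmetric] sum_distrib_right[symmetric])
  also have "\<dots> = (\<Sum>v\<in>V. (1 / 2 - of_bool (\<not> good v)) * (real (card (T v)) * real (card (B - T v))))"
  proof (intro sum.cong refl)
    fix v
    have "{x \<in> B. x \<in> T v} = T v" "{x \<in> B. x \<notin> T v} = B - T v" by (auto simp: T_def)
    then show "(1 / 2 - of_bool (\<not> good v)) *
      ((\<Sum>x\<in>B. of_bool (x \<in> T v)) * (\<Sum>y\<in>B. of_bool (y \<notin> T v))) =
      (1 / 2 - of_bool (\<not> good v)) * (real (card (T v)) * real (card (B - T v)))"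
      by (simp only: real_card_eq_sum_of_bool[OF fin(1), symmetric])
  qed
  finally have sumF: "(\<Sum>x\<in>B. \<Sum>y\<in>B. F x y) =
    (\<Sum>v\<in>V. (1 / 2 - of_bool (\<not> good v)) * (real (card (T v)) * real (card (B - T v))))" .
  have cs: "card (T v) + card (B - T v) = 4 * t" for v
    using card_Int_Diff[OF fin(1), of "T v"] t(1) by (simp add: T_def Int_def)
  have "(\<Sum>v\<in>V. 2 * (real t)\<^sup>2 - 7 / 8 * (real (card (T v)) - real (card (B - T v)))\<^sup>2)
      \<le> (\<Sum>x\<in>B. \<Sum>y\<in>B. F x y)"
    unfolding sumF good_def by (intro sum_mono block_contribution_bound cs)
  also have "\<dots> = (\<Sum>(x, y)\<in>P. F x y + F y x)"
    unfolding P_def by (rule sum_symmetrised_pairs[symmetric, OF fin(1) e]) (simp add: F_def d_def \<beta>_def)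
  finally have "(\<Sum>v\<in>V. 2 * (real t)\<^sup>2 - 7 / 8 * (real (card (T v)) - real (card (B - T v)))\<^sup>2) / (3 * real t)
      \<le> (\<Sum>(x, y)\<in>P. F x y + F y x) / (3 * real t)"
    by (intro divide_right_mono) auto
  also have "\<dots> = (\<Sum>(x, y)\<in>P. (F x y + F y x) / (3 * real t) - 2 ^ (4 * t)) + real (card P) * 2 ^ (4 * t)"
    by (simp add: sum_divide_distrib sum_subtractf case_prod_unfold)
  also have "(\<Sum>(x, y)\<in>P. (F x y + F y x) / (3 * real t) - 2 ^ (4 * t)) \<le> real (card Q)"
    unfolding Q(2) of_nat_sum using pair by (intro sum_mono) (auto split: prod.splits)
  also have "real (card P) * 2 ^ (4 * t) \<le> (4 * real t)\<^sup>2 * 2 ^ (4 * t)"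
    using cardP by (intro mult_right_mono) auto
  finally have "(\<Sum>v\<in>V. 2 * (real t)\<^sup>2 - 7 / 8 * (real (card (T v)) - real (card (B - T v)))\<^sup>2) / (3 * real t)
      - (4 * real t)\<^sup>2 * 2 ^ (4 * t) \<le> real (card Q)" by simp
  then show ?thesis using Q(1) TB by (intro exI[of _ Q] conjI) (simp_all add: T_def)
qed

section \<open>Packing in balanced bipartite orientations\<close>

text \<open>
  One side \<open>U\<close> is cut into blocks of size 100, up to fewer than 100 remaining vertices, and each block
  is packed with \<open>t = 25\<close>. The vectors of signs \<open>\<sigma>\<close> sum to zero over \<open>U\<close>, so the partition can be chosen
  such that the in-degree and the out-degree of a vertex of \<open>V\<close> in a block differ by about \<open>sqrt 100\<close> in
  quadratic mean or less.
  The main term is \<open>15.5 q n\<close> with \<open>q\<close> close to \<open>m / 100\<close>, that is, about \<open>0.155 m n\<close>; rounding costs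
  at most \<open>10 ^ 4 * 2 ^ 100\<close> cycles in each block, which is negligible once \<open>n\<close> is large.
\<close>

lemma exists_large_C4_packing:
  fixes U V :: "'a set"
  assumes fin: "finite U" "finite V" and UV: "U \<inter> V = {}"
    and asym: "\<And>x v. (x, v) \<in> E \<Longrightarrow> (v, x) \<notin> E"
    and cross: "\<And>x v. x \<in> U \<Longrightarrow> v \<in> V \<Longrightarrow> (x, v) \<in> E \<or> (v, x) \<in> E"
    and degU: "\<And>x. x \<in> U \<Longrightarrow> card {v \<in> V. (x, v) \<in> E} = card {v \<in> V. (v, x) \<in> E}"
    and degV: "\<And>v. v \<in> V \<Longrightarrow> card {x \<in> U. (x, v) \<in> E} = card {x \<in> U. (v, x) \<in> E}"
    and large: "card U \<ge> 10 ^ 5 * 2 ^ 100" "card V \<ge> 10 ^ 5 * 2 ^ 100"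
  shows "\<exists>Q. C4_packing E Q \<and> real (card Q) \<ge> 3 / 20 * (real (card U) * real (card V))"
proof -
  define m n q where "m = card U" and "n = card V" and "q = card U div 100"
  define K :: real where "K = 2 ^ 100"
  have K: "K \<ge> 1" by (simp add: K_def)
  have mn: "real m \<ge> 10 ^ 5 * K" "real n \<ge> 10 ^ 5 * K"
    using of_nat_mono[OF large(1), where 'a = real] of_nat_mono[OF large(2), where 'a = real]
    by (simp_all add: m_def n_def K_def)
  have qm: "q * 100 \<le> m" "m \<le> q * 100 + 99" by (simp_all add: q_def m_def)
  have "real m > 99" using mn(1) K by simp
  then have q: "q > 0" using qm(2) by (cases "q = 0") simp_all
  obtain X where X: "X \<subseteq> U" "card X = q * 100" "finite X"
    using obtain_subset_with_card_n[of "q * 100" U] qm(1) by (auto simp: m_def)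
  define \<sigma> :: "'a \<Rightarrow> 'a \<Rightarrow> real" where "\<sigma> = (\<lambda>v x. if (x, v) \<in> E then 1 else - 1)"
  have sum\<sigma>: "(\<Sum>x\<in>S. \<sigma> v x) = real (card {x \<in> S. (x, v) \<in> E}) - real (card {x \<in> S. (v, x) \<in> E})"
    if "S \<subseteq> U" "v \<in> V" for S v
  proof -
    have S: "finite S" using that(1) fin(1) finite_subset by blast
    have "(\<Sum>x\<in>S. \<sigma> v x) = (\<Sum>x\<in>S. of_bool ((x, v) \<in> E) - of_bool ((v, x) \<in> E))"
    proof (rule sum.cong[OF refl])
      fix x assume "x \<in> S"
      then have "(v, x) \<in> E \<longleftrightarrow> (x, v) \<notin> E" using asym cross that by blast
      then show "\<sigma> v x = of_bool ((x, v) \<in> E) - of_bool ((v, x) \<in> E)" by (simp add: \<sigma>_def)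
    qed
    then show ?thesis by (simp add: sum_subtractf real_card_eq_sum_of_bool[OF S])
  qed
  obtain g where g: "\<And>j. j < q \<Longrightarrow> card {x \<in> X. g x = j} = 100"
    and gsum: "(\<Sum>j<q. \<Sum>v\<in>V. (\<Sum>x | x \<in> X \<and> g x = j. \<sigma> v x)\<^sup>2)
      \<le> real (100 * q * card V) + (\<Sum>v\<in>V. (\<Sum>x\<in>X. \<sigma> v x)\<^sup>2) / real q"
  proof -
    have "(\<sigma> v x)\<^sup>2 \<le> 1" for v x by (simp add: \<sigma>_def)
    from exists_balanced_partition[OF fin(2) q X(3,2), of \<sigma>, OF this] that show ?thesis by blast
  qed
  define B where "B = (\<lambda>j. {x \<in> X. g x = j})"
  have B: "B j \<subseteq> U" "finite (B j)" for j using X by (auto simp: B_def)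
  have half: "card {v \<in> V. (x, v) \<in> E} = n div 2" if "x \<in> U" for x
  proof -
    have "V = {v \<in> V. (x, v) \<in> E} \<union> {v \<in> V. (v, x) \<in> E}" using cross that by auto
    moreover have "{v \<in> V. (x, v) \<in> E} \<inter> {v \<in> V. (v, x) \<in> E} = {}" using asym by auto
    ultimately have "n = card {v \<in> V. (x, v) \<in> E} + card {v \<in> V. (v, x) \<in> E}"
      unfolding n_def using fin(2) by (metis (no_types, lifting) card_Un_disjoint finite_Un)
    then show ?thesis using degU[OF that] by simp
  qed
  have "\<exists>Q. \<forall>j\<in>{..<q}. C4_packing (E \<inter> (B j \<times> V \<union> V \<times> B j)) (Q j) \<and>
      (\<Sum>v\<in>V. 2 * (real 25)\<^sup>2 - 7 / 8 * (\<Sum>x\<in>B j. \<sigma> v x)\<^sup>2) / (3 * real 25)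
        - (4 * real 25)\<^sup>2 * 2 ^ (4 * 25) \<le> real (card (Q j))"
  proof (rule bchoice, rule ballI)
    fix j assume "j \<in> {..<q}"
    then have "card (B j) = 4 * 25" using g by (simp add: B_def)
    then have "\<exists>Q. C4_packing (E \<inter> (B j \<times> V \<union> V \<times> B j)) Q \<and> real (card Q) \<ge>
      (\<Sum>v\<in>V. 2 * (real 25)\<^sup>2 -
        7 / 8 * (real (card {x \<in> B j. (x, v) \<in> E}) - real (card {x \<in> B j. (v, x) \<in> E}))\<^sup>2) / (3 * real 25)
      - (4 * real 25)\<^sup>2 * 2 ^ (4 * 25)"
      using B(1)[of j] UV cross half
      by (intro exists_C4_packing_in_block[OF B(2) fin(2) _ asym, where h = "n div 2"]) (blast | simp)+
    then show "\<exists>Q. C4_packing (E \<inter> (B j \<times> V \<union> V \<times> B j)) Q \<and>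
      (\<Sum>v\<in>V. 2 * (real 25)\<^sup>2 - 7 / 8 * (\<Sum>x\<in>B j. \<sigma> v x)\<^sup>2) / (3 * real 25)
        - (4 * real 25)\<^sup>2 * 2 ^ (4 * 25) \<le> real (card Q)"
      by (simp only: sum\<sigma>[OF B(1)] cong: sum.cong)
  qed
  then obtain Q where Q: "\<And>j. j < q \<Longrightarrow> C4_packing (E \<inter> (B j \<times> V \<union> V \<times> B j)) (Q j)"
    and cardQ: "\<And>j. j < q \<Longrightarrow>
      (\<Sum>v\<in>V. 1250 - 7 / 8 * (\<Sum>x\<in>B j. \<sigma> v x)\<^sup>2) / 75 - 10000 * K \<le> real (card (Q j))"
    by (auto simp: K_def)
  have "disjoint_family_on (\<lambda>j. E \<inter> (B j \<times> V \<union> V \<times> B j)) {..<q}"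
    using B UV by (fastforce simp: disjoint_family_on_def B_def)
  note UN = C4_packing_UN[of "{..<q}", OF _ Q this]
  have pack: "C4_packing E (\<Union>j<q. Q j)"
    by (rule C4_packing_mono[OF UN(1)]) auto
  have "(\<Sum>j<q. (\<Sum>v\<in>V. 1250 - 7 / 8 * (\<Sum>x\<in>B j. \<sigma> v x)\<^sup>2) / 75 - 10000 * K) \<le> (\<Sum>j<q. real (card (Q j)))"
    by (intro sum_mono cardQ) auto
  also have "(\<Sum>j<q. real (card (Q j))) = real (card (\<Union>j<q. Q j))"
    by (subst UN(2)) auto
  also have "(\<Sum>j<q. (\<Sum>v\<in>V. 1250 - 7 / 8 * (\<Sum>x\<in>B j. \<sigma> v x)\<^sup>2) / 75 - 10000 * K)
      = (1250 * (real q * real n) - 7 / 8 * (\<Sum>j<q. \<Sum>v\<in>V. (\<Sum>x\<in>B j. \<sigma> v x)\<^sup>2)) / 75 - 10000 * (K * real q)"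
    by (simp add: sum_subtractf sum_divide_distrib[symmetric] sum_distrib_left[symmetric] n_def)
  finally have lower: "(1250 * (real q * real n) - 7 / 8 * (\<Sum>j<q. \<Sum>v\<in>V. (\<Sum>x\<in>B j. \<sigma> v x)\<^sup>2)) / 75
      - 10000 * (K * real q) \<le> real (card (\<Union>j<q. Q j))" .
  \<comment> \<open>The signs of the remaining vertices are the only contribution to the sum over \<open>X\<close>, up to sign.\<close>
  have "(\<Sum>x\<in>X. \<sigma> v x)\<^sup>2 \<le> 100\<^sup>2" if v: "v \<in> V" for v
  proof -
    have "(\<Sum>x\<in>X. \<sigma> v x) + (\<Sum>x\<in>U - X. \<sigma> v x) = (\<Sum>x\<in>U. \<sigma> v x)"
      using sum.subset_diff[OF X(1) fin(1), of "\<sigma> v"] by simp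
    also have "\<dots> = 0" using sum\<sigma>[OF order_refl v] degV[OF v] by simp
    finally have "\<bar>\<Sum>x\<in>X. \<sigma> v x\<bar> = \<bar>\<Sum>x\<in>U - X. \<sigma> v x\<bar>" by simp
    also have "\<dots> \<le> (\<Sum>x\<in>U - X. 1)"
      by (rule order_trans[OF sum_abs sum_mono]) (simp add: \<sigma>_def)
    also have "\<dots> \<le> 100" using qm(2) X fin(1) by (simp add: card_Diff_subset m_def)
    finally show ?thesis by (metis abs_le_square_iff abs_numeral)
  qed
  then have "(\<Sum>v\<in>V. (\<Sum>x\<in>X. \<sigma> v x)\<^sup>2) \<le> (\<Sum>v\<in>V. 100\<^sup>2)" by (rule sum_mono)
  also have "(\<Sum>v\<in>V. 100\<^sup>2) = 10000 * real n" by (simp add: n_def)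
  finally have "(\<Sum>v\<in>V. (\<Sum>x\<in>X. \<sigma> v x)\<^sup>2) / real q \<le> 10000 * real n / real q"
    by (rule divide_right_mono) simp
  also have "\<dots> \<le> 10000 * real n / 1" using q by (intro divide_left_mono) auto
  finally have squares: "(\<Sum>j<q. \<Sum>v\<in>V. (\<Sum>x\<in>B j. \<sigma> v x)\<^sup>2) \<le> 100 * (real q * real n) + 10000 * real n"
    using gsum by (simp add: B_def n_def)
  have "(real m - 99) * real n \<le> 100 * real q * real n"
    using qm(2) by (intro mult_right_mono) auto
  moreover have "K * (100 * real q) \<le> K * real m" using qm(1) K by (intro mult_left_mono) auto
  moreover have "10 ^ 5 * K * real n \<le> real m * real n" using mn by (intro mult_right_mono) auto
  moreover have "real m * (10 ^ 5 * K) \<le> real m * real n" using mn by (intro mult_left_mono) auto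
  moreover have "1 * real n \<le> K * real n" using K by (intro mult_right_mono) auto
  ultimately have "3 / 20 * (real m * real n) \<le> real (card (\<Union>j<q. Q j))"
    using lower squares by (simp add: algebra_simps)
  then show ?thesis using pack by (auto simp: m_def n_def)
qed

section \<open>Directed 4-cycles as subgraphs\<close>

lemma (in digraph) in_degree_eq_card_dominators: "in_degree G v = card {u. (u, v) \<in> arcs_ends G}"
proof -
  have "tail G ` in_arcs G v = {u. (u, v) \<in> arcs_ends G}"
    by (auto simp: in_arcs_def arcs_ends_conv)
  moreover have "inj_on (tail G) (in_arcs G v)"
    using no_multi_arcs by (auto simp: inj_on_def in_arcs_def arc_to_ends_def)
  ultimately show ?thesis by (metis card_image in_degree_def)
qed

lemma (in digraph) out_degree_eq_card_dominated: "out_degree G v = card {u. (v, u) \<in> arcs_ends G}"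
proof -
  have "head G ` out_arcs G v = {u. (v, u) \<in> arcs_ends G}"
    by (auto simp: out_arcs_def arcs_ends_conv)
  moreover have "inj_on (head G) (out_arcs G v)"
    using no_multi_arcs by (auto simp: inj_on_def out_arcs_def arc_to_ends_def)
  ultimately show ?thesis by (metis card_image out_degree_def)
qed

text \<open>
  The subgraph formed by the cycle \<open>x \<rightarrow> v \<rightarrow> y \<rightarrow> w \<rightarrow> x\<close>. Only the arcs of \<open>D\<close> with the right end points are
  kept; \<open>tail\<close> and \<open>head\<close> remain those of \<open>D\<close>.
\<close>

definition C4_subgraph :: "('a, 'b) pre_digraph \<Rightarrow> 'a \<times> 'a \<times> 'a \<times> 'a \<Rightarrow> ('a, 'b) pre_digraph" where
  "C4_subgraph D = (\<lambda>(x, v, y, w). \<lparr>verts = {x, v, y, w},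
     arcs = {e \<in> arcs D. arc_to_ends D e \<in> C4_arcs (x, v, y, w)}, tail = tail D, head = head D\<rparr>)"

lemma C4_copy_C4_subgraph:
  assumes "digraph D" "distinct [x, v, y, w]" "C4_arcs (x, v, y, w) \<subseteq> arcs_ends D"
  shows "C4_copy (C4_subgraph D (x, v, y, w)) D"
proof -
  interpret D: digraph D by fact
  define H where "H = C4_subgraph D (x, v, y, w)"
  have H: "verts H = {x, v, y, w}" "tail H = tail D" "head H = head D"
      "arcs H = {e \<in> arcs D. (tail D e, head D e) \<in> {(x, v), (v, y), (y, w), (w, x)}}"
    by (simp_all add: H_def C4_subgraph_def C4_arcs_def arc_to_ends_def)
  have wfH: "wf_digraph H" by unfold_locales (auto simp: H)
  have "{x, v, y, w} \<subseteq> verts D"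
    using assms(3) by (auto simp: C4_arcs_def arcs_ends_conv)
  then have sub: "subgraph H D"
    using wfH D.wf_digraph by (auto simp: subgraph_def H compatible_def)
  define f :: "'a \<Rightarrow> nat" where
    "f = (\<lambda>z. if z = x then 0 else if z = v then 1 else if z = y then 2 else 3)"
  have f: "f x = 0" "f v = 1" "f y = 2" "f w = 3" using assms(2) by (auto simp: f_def)
  define \<phi> :: "('a, 'b, nat, nat \<times> nat) digraph_isomorphism" where
    "\<phi> = \<lparr>iso_verts = f, iso_arcs = (\<lambda>e. (f (tail D e), f (head D e))), iso_head = snd, iso_tail = fst\<rparr>"
  have ends: "(\<lambda>e. (tail D e, head D e)) ` arcs H = {(x, v), (v, y), (y, w), (w, x)}"
    using assms(3) by (auto simp: H C4_arcs_def arcs_ends_conv image_iff)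
  have "inj_on (iso_arcs \<phi>) (arcs H)"
  proof (rule inj_onI)
    fix e e' assume e: "e \<in> arcs H" "e' \<in> arcs H" "iso_arcs \<phi> e = iso_arcs \<phi> e'"
    have "inj_on f (verts H)" by (simp add: inj_on_def f H)
    then have "arc_to_ends D e = arc_to_ends D e'"
      using e wf_digraph.wellformed[OF wfH] H(2,3)
      by (auto simp: \<phi>_def arc_to_ends_def dest: inj_onD)
    then show "e = e'" using D.no_multi_arcs e(1,2) H(4) by auto
  qed
  then have "pre_digraph.digraph_isomorphism H \<phi>"
    using wfH by (simp add: pre_digraph.digraph_isomorphism_def inj_on_def f H(1-3) \<phi>_def)
  moreover have "directed_C4 = app_iso \<phi> H"
  proof -
    have "(\<lambda>e. (f (tail D e), f (head D e))) ` arcs H = map_prod f f ` (\<lambda>e. (tail D e, head D e)) ` arcs H"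
      by (simp add: image_image)
    also have "\<dots> = {(0, 1), (1, 2), (2, 3), (3, 0)}" by (simp add: ends f)
    finally show ?thesis by (simp add: directed_C4_def app_iso_def with_proj_def \<phi>_def H(1) f)
  qed
  ultimately show ?thesis using sub unfolding C4_copy_def digraph_iso_def H_def by blast
qed

lemma C4_subgraphs_of_packing:
  assumes "digraph D" "C4_packing (arcs_ends D) Q"
  shows "finite (C4_subgraph D ` Q)" "\<forall>H\<in>C4_subgraph D ` Q. C4_copy H D"
    "pairwise_arc_disjoint (C4_subgraph D ` Q)" "card (C4_subgraph D ` Q) = card Q"
proof -
  have Q: "finite Q" "\<And>x v y w. (x, v, y, w) \<in> Q \<Longrightarrow> distinct [x, v, y, w]"
    "\<And>c. c \<in> Q \<Longrightarrow> C4_arcs c \<subseteq> arcs_ends D"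
    "\<And>c c'. c \<in> Q \<Longrightarrow> c' \<in> Q \<Longrightarrow> c \<noteq> c' \<Longrightarrow> C4_arcs c \<inter> C4_arcs c' = {}"
    using assms(2) unfolding C4_packing_def disjoint_family_on_def by blast+
  show "finite (C4_subgraph D ` Q)" using Q(1) by simp
  show copy: "\<forall>H\<in>C4_subgraph D ` Q. C4_copy H D"
    using Q(2,3) C4_copy_C4_subgraph[OF assms(1)] by auto
  have arcs: "arcs (C4_subgraph D c) = {e \<in> arcs D. arc_to_ends D e \<in> C4_arcs c}" for c
    by (simp add: C4_subgraph_def split: prod.splits)
  have dis: "arcs (C4_subgraph D c) \<inter> arcs (C4_subgraph D c') = {}" if "c \<in> Q" "c' \<in> Q" "c \<noteq> c'" for c c'
    using Q(4)[OF that] by (auto simp: arcs)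
  have ne: "arcs (C4_subgraph D c) \<noteq> {}" if "c \<in> Q" for c
  proof -
    obtain a where "a \<in> C4_arcs c" by (cases c) (auto simp: C4_arcs_def)
    then show ?thesis using Q(3)[OF that] by (auto simp: arcs arcs_ends_def)
  qed
  show "pairwise_arc_disjoint (C4_subgraph D ` Q)"
    unfolding pairwise_arc_disjoint_def
  proof (rule pairwiseI)
    fix H H' assume "H \<in> C4_subgraph D ` Q" "H' \<in> C4_subgraph D ` Q" "H \<noteq> H'"
    then obtain c c' where "c \<in> Q" "c' \<in> Q" "c \<noteq> c'" "H = C4_subgraph D c" "H' = C4_subgraph D c'"
      by blast
    then show "arcs H \<inter> arcs H' = {}" using dis by simp
  qed
  have "inj_on (C4_subgraph D) Q"
    using dis ne by (intro inj_onI) (metis inf.idem)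
  then show "card (C4_subgraph D ` Q) = card Q" by (rule card_image)
qed

section \<open>Eulerian orientations of complete bipartite graphs\<close>

theorem theorem1p1:
  shows "\<forall>\<epsilon>::real. \<epsilon> > 0 \<longrightarrow>
    (\<exists>M::nat. \<forall>m n :: nat. min m n \<ge> M \<longrightarrow>
      (\<forall>(G :: ('a,'b) pre_digraph) (D :: ('a,'c) pre_digraph).
         complete_bipartite_digraph m n G \<and> eulerian_orientation D G \<longrightarrow>
         (\<exists>F. finite F \<and> (\<forall>H \<in> F. C4_copy H D) \<and> pairwise_arc_disjoint F \<and>
              real (card F) \<ge> 1 / (4 + sqrt 8) * (real m * real n) * (1 - \<epsilon>))))"
proof (intro allI impI exI[of _ "10 ^ 5 * 2 ^ 100"], elim conjE)
  fix \<epsilon> :: real and m n :: nat and G :: "('a, 'b) pre_digraph" and D :: "('a, 'c) pre_digraph"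
  assume \<epsilon>: "\<epsilon> > 0" and large: "min m n \<ge> 10 ^ 5 * 2 ^ 100"
    and G: "complete_bipartite_digraph m n G" and D: "eulerian_orientation D G"
  from G obtain U V where UV: "verts G = U \<union> V" "U \<inter> V = {}" "card U = m" "card V = n"
    "arcs_ends G = U \<times> V \<union> V \<times> U" and "graph G"
    by (auto simp: complete_bipartite_digraph_def)
  then interpret G: graph G by simp
  have fin: "finite U" "finite V" using G.finite_verts UV(1) by auto
  define E where "E = arcs_ends D"
  from D have "digraph D" and vD: "verts D = U \<union> V" and E: "E \<inter> E\<inverse> = {}" "E \<union> E\<inverse> = U \<times> V \<union> V \<times> U"
    and deg: "\<And>v. v \<in> U \<union> V \<Longrightarrow> in_degree D v = out_degree D v"
    using UV by (auto simp: eulerian_orientation_def orientation_def E_def)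
  then interpret D: digraph D by simp
  have bal: "card {u. (u, v) \<in> E} = card {u. (v, u) \<in> E}" if "v \<in> U \<union> V" for v
    using deg[OF that] by (simp add: D.in_degree_eq_card_dominators D.out_degree_eq_card_dominated E_def)
  have sub: "E \<subseteq> U \<times> V \<union> V \<times> U" using E(2) by blast
  have "\<exists>Q. C4_packing E Q \<and> 3 / 20 * (real (card U) * real (card V)) \<le> real (card Q)"
  proof (rule exists_large_C4_packing[OF fin UV(2)])
    show "(v, x) \<notin> E" if "(x, v) \<in> E" for x v using E(1) that by blast
    show "(x, v) \<in> E \<or> (v, x) \<in> E" if "x \<in> U" "v \<in> V" for x v using E(2) that by blast
    show "card {v \<in> V. (x, v) \<in> E} = card {v \<in> V. (v, x) \<in> E}" if "x \<in> U" for x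
    proof -
      have "{v \<in> V. (x, v) \<in> E} = {v. (x, v) \<in> E}" "{v \<in> V. (v, x) \<in> E} = {v. (v, x) \<in> E}"
        using sub UV(2) that by auto
      then show ?thesis using bal[of x] that by simp
    qed
    show "card {x \<in> U. (x, v) \<in> E} = card {x \<in> U. (v, x) \<in> E}" if "v \<in> V" for v
    proof -
      have "{x \<in> U. (x, v) \<in> E} = {x. (x, v) \<in> E}" "{x \<in> U. (v, x) \<in> E} = {x. (v, x) \<in> E}"
        using sub UV(2) that by auto
      then show ?thesis using bal[of v] that by simp
    qed
  qed (use large UV in simp_all)
  then obtain Q where Q: "C4_packing (arcs_ends D) Q" "3 / 20 * (real m * real n) \<le> real (card Q)"
    using UV by (auto simp: E_def)
  \<comment> \<open>The bound \<open>3/20\<close> already exceeds \<open>1 / (4 + sqrt 8)\<close>, so the threshold does not depend on \<open>\<epsilon>\<close>.\<close>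
  have "8 / 3 \<le> sqrt 8" by (rule real_le_rsqrt) (simp add: power2_eq_square)
  then have "1 / (4 + sqrt 8) \<le> 3 / 20" by (simp add: field_simps)
  then have "1 / (4 + sqrt 8) * (real m * real n) \<le> 3 / 20 * (real m * real n)"
    by (rule mult_right_mono) simp
  moreover have "1 / (4 + sqrt 8) * (real m * real n) * (1 - \<epsilon>) \<le> 1 / (4 + sqrt 8) * (real m * real n) * 1"
    using \<epsilon> by (intro mult_left_mono) auto
  ultimately have "1 / (4 + sqrt 8) * (real m * real n) * (1 - \<epsilon>) \<le> real (card (C4_subgraph D ` Q))"
    using Q(2) C4_subgraphs_of_packing(4)[OF \<open>digraph D\<close> Q(1)] by linarith
  then show "\<exists>F. finite F \<and> (\<forall>H \<in> F. C4_copy H D) \<and> pairwise_arc_disjoint F \<and>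
      real (card F) \<ge> 1 / (4 + sqrt 8) * (real m * real n) * (1 - \<epsilon>)"
    using C4_subgraphs_of_packing(1-3)[OF \<open>digraph D\<close> Q(1)] by blast
qed

end
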